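(* Let $a,b,c$ be integers with $2\le a<b<c$, $\gcd(a,b,c)=1$ and $c\neq a+b$. Put $S=\{a,b,c\}$, $B=\{a,b\}$ and $\rho=c\bmod(a+b)$. Suppose that $\rho\in\Theta_{a+b}\cup\Theta_{c+a}\cup\Theta_{c+b}$, and let $P$ be the least element of $\{a+b,\,c+a,\,c+b\}$ such that $\rho\in\Theta_P$. Then the nim-value sequence $\mathcal G_S$ is purely periodic, its least period is $P$, and $$\mathcal W_0(S)=\begin{cases}\mathcal W_0(B), & \rho\in\Theta_{a+b},\\ T_P, & \text{otherwise.}\end{cases}$$
   Context: $\mathbb N=\{0,1,2,\dots\}$. For a finite nonempty set $S$ of positive integers, the subtraction game $S$ has positions $x\in\mathbb N$ and legal moves $x\mapsto x-s$ for $s\in S$, $s\le x$; a player unable to move loses. The nim-value is $\mathcal G_S(x)=\operatorname{mex}\{\mathcal G_S(x-s):s\in S,\ s\le x\}$, where mex is the least non-negative integer not in the set, and $\mathcal W_0(S)=\{x\in\mathbb N:\mathcal G_S(x)=0\}$ is the set of $\mathrm P$-positions. $\mathcal G_S$ is purely periodic if there is $p\ge1$ with $\mathcal G_S(x+p)=\mathcal G_S(x)$ for all $x\ge0$; the least such $p$ is the least period. Integer intervals: $[u,v]=\{u,\dots,v\}$, $[u,v)=\{u,\dots,v-1\}$ (empty if there are no such integers). Given $a<b$, write $B=\{a,b\}$, $\delta=b-a=\eta a+\varepsilon$ with $\eta=\lfloor\delta/a\rfloor$, $0\le\varepsilon<a$, and put $\mathcal Z=\mathcal W_0(B)\cap[0,a+b)$,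 $D=[a,b)\setminus\mathcal Z$, and $$\Lambda=\begin{cases}[(\eta+1)a,\ (\eta+1)a+\varepsilon),&\eta\text{ even},\\ [\eta a+\varepsilon,\ (\eta+1)a),&\eta\text{ odd}.\end{cases}$$ These sets are viewed as subsets of the circle $\mathbb Z/(a+b)\mathbb Z$, and residues are identified with $[0,a+b)$. The admissible sets $\Theta_{a+b},\Theta_{c+a},\Theta_{c+b}\subseteq\mathbb Z/(a+b)\mathbb Z$ (they depend only on $a,b$; the subscripts label the candidate periods) are defined, with translates read modulo $a+b$, by: $\rho\in\Theta_{a+b}\iff\mathcal Z\cap(\mathcal Z+\rho)=\varnothing$; $\rho\in\Theta_{c+a}\iff\mathcal Z\cap[0,\delta)\cap(\mathcal Z+(\delta-\rho))=\varnothing$; $\rho\in\Theta_{c+b}\iff(\rho+\Lambda)\cap\mathcal Z=\varnothing$ and $(\rho+D)\cap\Lambda=\varnothing$. For $P\ge c$, $T_P=\{x\in\mathbb N:(x\bmod P)\in\mathcal W_0(B)\text{ and }(x\bmod P)-c\notin\mathcal W_0(B)\}$, with the convention $y\notin\mathcal W_0(B)$ for $y<0$. *)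

theory Defs
  imports Main
begin

definition mex :: "nat set \<Rightarrow> nat" where
  "mex A = (LEAST n. n \<notin> A)"

(* The guard 0 < s is there only for termination; it is vacuous for a set S of
   positive integers, see nim_value_rec. *)
function nim_value :: "nat set \<Rightarrow> nat \<Rightarrow> nat" where
  "nim_value S x = mex ((\<lambda>s. nim_value S (x - s)) ` {s \<in> S. 0 < s \<and> s \<le> x})"
  by pat_completeness auto
termination
  by (relation "measure snd") auto

declare nim_value.simps [simp del]

lemma nim_value_rec:
  assumes "0 \<notin> S"
  shows "nim_value S x = mex {nim_value S (x - s) |s. s \<in> S \<and> s \<le> x}"
proof -
  have "(\<lambda>s. nim_value S (x - s)) ` {s \<in> S. 0 < s \<and> s \<le> x}
      = {nim_value S (x - s) |s. s \<in> S \<and> s \<le> x}"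
    using assms by (auto intro: gr0I)
  then show ?thesis
    by (subst nim_value.simps) simp
qed

definition P_positions :: "nat set \<Rightarrow> nat set" where
  "P_positions S = {x. nim_value S x = 0}"

definition is_period :: "(nat \<Rightarrow> 'a) \<Rightarrow> nat \<Rightarrow> bool" where
  "is_period f p \<longleftrightarrow> 1 \<le> p \<and> (\<forall>x. f (x + p) = f x)"

definition purely_periodic :: "(nat \<Rightarrow> 'a) \<Rightarrow> bool" where
  "purely_periodic f \<longleftrightarrow> (\<exists>p. is_period f p)"

definition least_period :: "(nat \<Rightarrow> 'a) \<Rightarrow> nat" where
  "least_period f = (LEAST p. is_period f p)"

(* Subsets of the circle Z/mZ are represented by sets of residues in {0..<m};
   this is the translate A + t read modulo m. *)
definition translate_mod :: "nat \<Rightarrow> int \<Rightarrow> nat set \<Rightarrow> nat set" where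
  "translate_mod m t A = (\<lambda>x. nat ((int x + t) mod int m)) ` A"

definition Z_set :: "nat \<Rightarrow> nat \<Rightarrow> nat set" where
  "Z_set a b = P_positions {a, b} \<inter> {0..<a + b}"

definition D_set :: "nat \<Rightarrow> nat \<Rightarrow> nat set" where
  "D_set a b = {a..<b} - Z_set a b"

(* All definitions below are meant for 0 < a < b, so b - a is the true difference. *)
definition Lambda_set :: "nat \<Rightarrow> nat \<Rightarrow> nat set" where
  "Lambda_set a b =
    (let \<delta> = b - a; \<eta> = \<delta> div a; \<epsilon> = \<delta> mod a
     in if even \<eta> then {(\<eta> + 1) * a..<(\<eta> + 1) * a + \<epsilon>}
        else {\<eta> * a + \<epsilon>..<(\<eta> + 1) * a})"

definition Theta_ab :: "nat \<Rightarrow> nat \<Rightarrow> nat set" where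
  "Theta_ab a b =
    {\<rho> \<in> {0..<a + b}. Z_set a b \<inter> translate_mod (a + b) (int \<rho>) (Z_set a b) = {}}"

definition Theta_ca :: "nat \<Rightarrow> nat \<Rightarrow> nat set" where
  "Theta_ca a b =
    {\<rho> \<in> {0..<a + b}.
      Z_set a b \<inter> {0..<b - a} \<inter>
        translate_mod (a + b) (int (b - a) - int \<rho>) (Z_set a b) = {}}"

definition Theta_cb :: "nat \<Rightarrow> nat \<Rightarrow> nat set" where
  "Theta_cb a b =
    {\<rho> \<in> {0..<a + b}.
      translate_mod (a + b) (int \<rho>) (Lambda_set a b) \<inter> Z_set a b = {} \<and>
      translate_mod (a + b) (int \<rho>) (D_set a b) \<inter> Lambda_set a b = {}}"

(* p is one of the candidate periods a + b, c + a, c + b, and the residue \<rho> lies in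
   the admissible set labelled by p; for a < b < c the three candidates are distinct. *)
definition admissible_period :: "nat \<Rightarrow> nat \<Rightarrow> nat \<Rightarrow> nat \<Rightarrow> nat \<Rightarrow> bool" where
  "admissible_period a b c \<rho> p \<longleftrightarrow>
    p = a + b \<and> \<rho> \<in> Theta_ab a b \<or>
    p = c + a \<and> \<rho> \<in> Theta_ca a b \<or>
    p = c + b \<and> \<rho> \<in> Theta_cb a b"

(* The test c \<le> x mod p encodes the convention that negative integers are not P-positions. *)
definition T_set :: "nat \<Rightarrow> nat \<Rightarrow> nat \<Rightarrow> nat \<Rightarrow> nat set" where
  "T_set a b c p =
    {x. x mod p \<in> P_positions {a, b} \<and>
        \<not> (c \<le> x mod p \<and> x mod p - c \<in> P_positions {a, b})}"

end

theory Submission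
  imports Defs
begin

text \<open>Passing from \<open>x\<close> to \<open>x + P\<close> with \<open>P = s + t\<close>, \<open>s, t \<in> S\<close>, creates new options only by the moves
  larger than \<open>x\<close>, and the new options by \<open>s\<close> and \<open>t\<close>, namely \<open>x + t\<close> and \<open>x + s\<close>, never have the
  value of \<open>x\<close>.  So only the third move can obstruct the period \<open>P\<close>, and only at small \<open>x\<close>,
  where the value is \<open>0\<close> or \<open>1\<close>; value \<open>1\<close> reduces to value \<open>0\<close> by Ferguson's pairing property.  The
  condition defining \<open>\<Theta>\<^sub>c\<^sub>+\<^sub>a\<close> and the first one defining \<open>\<Theta>\<^sub>c\<^sub>+\<^sub>b\<close> say that this obstruction vanishes;
  the second one determines the P-positions in \<open>[c, c + b)\<close>.

  For minimality, the least period divides \<open>P\<close>.  On \<open>[0, P)\<close> the P-positions of \<open>S\<close> are P-positions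
  of \<open>B\<close> and miss the last \<open>a\<close> places, and \<open>[0, a)\<close> consists of P-positions.  This rigidity forces a
  proper divisor of \<open>P\<close> that is a period to be a multiple of \<open>a + b\<close>, so that \<open>\<rho> \<in> \<Theta>\<^sub>a\<^sub>+\<^sub>b\<close>, or else
  \<open>a\<close> to divide \<open>b\<close> and \<open>c\<close>.\<close>

section \<open>Nim-values of finite subtraction games\<close>

lemma mex_notin:
  assumes "finite A"
  shows "mex A \<notin> A"
proof -
  obtain n where "n \<notin> A"
    using assms ex_new_if_finite infinite_UNIV_nat by blast
  then show ?thesis
    unfolding mex_def by (rule LeastI)
qed

lemma less_mex_in: "n < mex A \<Longrightarrow> n \<in> A"
  unfolding mex_def using not_less_Least by blast

lemma mex_eqI:
  assumes "n \<notin> A" and "\<And>m. m < n \<Longrightarrow> m \<in> A"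
  shows "mex A = n"
  unfolding mex_def by (rule Least_equality) (use assms in \<open>auto simp: not_less [symmetric]\<close>)

lemma nim_value_option_neq:
  assumes "finite S" "0 \<notin> S" "s \<in> S" "s \<le> x"
  shows "nim_value S (x - s) \<noteq> nim_value S x"
proof -
  let ?A = "{nim_value S (x - s) |s. s \<in> S \<and> s \<le> x}"
  have "?A = (\<lambda>s. nim_value S (x - s)) ` {s \<in> S. s \<le> x}"
    by auto
  then have "finite ?A"
    using assms(1) by simp
  then have "nim_value S x \<notin> ?A"
    unfolding nim_value_rec [OF assms(2), of x] by (rule mex_notin)
  moreover have "nim_value S (x - s) \<in> ?A"
    using assms(3,4) by blast
  ultimately show ?thesis
    by metis
qed

lemma nim_value_add_neq:
  assumes "finite S" "0 \<notin> S" "s \<in> S"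
  shows "nim_value S (x + s) \<noteq> nim_value S x"
  using nim_value_option_neq [of S s "x + s"] assms by simp

lemma less_nim_valueD:
  assumes "0 \<notin> S" "n < nim_value S x"
  obtains s where "s \<in> S" "s \<le> x" "nim_value S (x - s) = n"
  using assms(2) less_mex_in unfolding nim_value_rec [OF assms(1), of x] by blast

lemma nim_value_eqI:
  assumes "0 \<notin> S"
    and "\<And>s. s \<in> S \<Longrightarrow> s \<le> x \<Longrightarrow> nim_value S (x - s) \<noteq> n"
    and "\<And>m. m < n \<Longrightarrow> \<exists>s\<in>S. s \<le> x \<and> nim_value S (x - s) = m"
  shows "nim_value S x = n"
  unfolding nim_value_rec [OF assms(1), of x]
  by (rule mex_eqI) (use assms(2,3) in blast)+

text \<open>One half of Ferguson's pairing property.\<close>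

lemma nim_value_one_imp_zero:
  assumes S: "finite S" "0 \<notin> S" "a \<in> S" and min: "\<And>s. s \<in> S \<Longrightarrow> a \<le> s"
  shows "nim_value S x = 1 \<Longrightarrow> a \<le> x \<and> nim_value S (x - a) = 0"
proof (induction x rule: less_induct)
  case (less x)
  have "a \<le> x"
  proof -
    obtain s where "s \<in> S" "s \<le> x"
      using less_nim_valueD [of S 0 x] S less.prems by auto
    then show ?thesis
      using min le_trans by blast
  qed
  moreover have "nim_value S (x - a) = 0"
  proof (rule ccontr)
    assume "nim_value S (x - a) \<noteq> 0"
    then obtain t where t: "t \<in> S" "t \<le> x - a" "nim_value S (x - a - t) = 0"
      using less_nim_valueD [of S 0 "x - a"] S by auto
    have "t > 0"
      using t S by (cases t) auto
    \<comment> \<open>\<open>x - t\<close> moves by \<open>a\<close> to the zero position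
      \<open>x - a - t\<close> and is an option of \<open>x\<close>, so its value exceeds 1. It then
      has an option of value 1, and the induction hypothesis turns that into a zero option of
      \<open>x - a - t\<close>.\<close>
    have "a \<le> x - t"
      using t \<open>a \<le> x\<close> by linarith
    then have "nim_value S (x - t) \<noteq> 0"
      using nim_value_option_neq [of S a "x - t"] S t by (metis diff_commute)
    moreover have "nim_value S (x - t) \<noteq> 1"
      using nim_value_option_neq [of S t x] S t less.prems by auto
    ultimately have "1 < nim_value S (x - t)"
      by linarith
    then obtain u where u: "u \<in> S" "u \<le> x - t" "nim_value S (x - t - u) = 1"
      using less_nim_valueD S by blast
    have "x - t - u < x"
      using \<open>t > 0\<close> t \<open>a \<le> x\<close> by linarith
    from less.IH [OF this u(3)] have "a \<le> x - t - u" "nim_value S (x - t - u - a) = 0"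
      by auto
    moreover have "u \<le> x - a - t" "x - a - t - u = x - t - u - a"
      using calculation(1) u(2) by linarith+
    ultimately show False
      using nim_value_option_neq [OF S(1,2) u(1), of "x - a - t"] t(3) by metis
  qed
  ultimately show ?case ..
qed

text \<open>By induction the moves \<open>s \<le> x\<close> reach the same values from
  \<open>x + P\<close> as from \<open>x\<close>. The other options of \<open>x + P\<close> cannot
  alter the mex as long as they avoid the value of \<open>x\<close>.\<close>

lemma nim_value_periodicI:
  assumes S: "finite S" "0 \<notin> S" and P: "\<And>s. s \<in> S \<Longrightarrow> s \<le> P"
    and new: "\<And>x s. s \<in> S \<Longrightarrow> x < s \<Longrightarrow> nim_value S (x + P - s) \<noteq> nim_value S x"
  shows "nim_value S (x + P) = nim_value S x"
proof (induction x rule: less_induct)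
  case (less x)
  have shift: "nim_value S (x + P - s) = nim_value S (x - s)" if "s \<in> S" "s \<le> x" for s
  proof -
    have "s > 0"
      using that S by (cases s) auto
    then show ?thesis
      using less.IH [of "x - s"] that by simp
  qed
  show ?case
  proof (rule nim_value_eqI [OF S(2)])
    fix s assume "s \<in> S" "s \<le> x + P"
    then show "nim_value S (x + P - s) \<noteq> nim_value S x"
      using new shift nim_value_option_neq [OF S] by (cases "s \<le> x") auto
  next
    fix m assume "m < nim_value S x"
    then obtain s where "s \<in> S" "s \<le> x" "nim_value S (x - s) = m"
      using less_nim_valueD S by blast
    then show "\<exists>s\<in>S. s \<le> x + P \<and> nim_value S (x + P - s) = m"
      using shift by (metis trans_le_add1)
  qed
qed

section \<open>Periods\<close>

lemma periodic_mult:
  fixes x k p :: nat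
  assumes "\<And>x. f (x + p) = f x"
  shows "f (x + k * p) = f x"
proof (induction k)
  case (Suc k)
  have "f (x + Suc k * p) = f (x + k * p + p)"
    by (simp add: algebra_simps)
  then show ?case
    using assms Suc by simp
qed simp

lemma periodic_mod:
  fixes x p :: nat
  assumes "\<And>x. f (x + p) = f x"
  shows "f (x mod p) = f x"
  using periodic_mult [of f p "x mod p" "x div p"] assms by simp

lemma is_period_least_period:
  assumes "is_period f P"
  shows "is_period f (least_period f)"
  unfolding least_period_def using assms by (rule LeastI)

text \<open>A nonzero remainder of \<open>P\<close> modulo the least period would be a smaller
  period.\<close>

lemma least_period_dvd:
  assumes "is_period f P"
  shows "least_period f dvd P"
proof (rule ccontr)
  define p where "p = least_period f"
  assume "\<not> least_period f dvd P"
  then have "P mod p > 0"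
    by (simp add: p_def dvd_eq_mod_eq_0)
  have p: "1 \<le> p" "\<And>x. f (x + p) = f x"
    using is_period_least_period [OF assms] by (auto simp: p_def is_period_def)
  have "f (x + P mod p) = f x" for x
  proof -
    have "f (x + P mod p) = f (x + P mod p + (P div p) * p)"
      by (rule periodic_mult [where f = f, OF p(2), symmetric])
    also have "x + P mod p + (P div p) * p = x + P"
      by simp
    finally show ?thesis
      using assms by (simp add: is_period_def)
  qed
  then have "is_period f (P mod p)"
    using \<open>P mod p > 0\<close> by (simp add: is_period_def)
  then have "p \<le> P mod p"
    unfolding p_def least_period_def by (rule Least_le)
  then show False
    using p(1) mod_less_divisor [of p P] by linarith
qed

section \<open>The game with two moves\<close>

text \<open>Unless \<open>r\<close> starts a block of length \<open>a\<close>, the numbers from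
  \<open>r\<close> to \<open>r + a - 1\<close> straddle two consecutive blocks, whose indices have
  opposite parity.\<close>

lemma even_div_interval:
  fixes r a :: nat
  assumes "0 < a" and "even (r div a)" and "even ((r + a - 1) div a)"
  shows "a dvd r"
proof (rule ccontr)
  assume "\<not> a dvd r"
  define q s where "q = r div a" and "s = r mod a"
  have r: "r = a * q + s"
    by (simp add: q_def s_def)
  have "0 < s" "s < a"
    using assms(1) \<open>\<not> a dvd r\<close> by (auto simp: s_def dvd_eq_mod_eq_0)
  then have "(r + a - 1) div a = q + 1"
    unfolding r by (intro div_nat_eqI) (auto simp: algebra_simps)
  then show False
    using assms by (simp add: q_def)
qed

locale two_moves =
  fixes a b :: nat
  assumes a_pos: "0 < a" and a_less_b: "a < b"
begin

abbreviation "G\<^sub>B \<equiv> nim_value {a, b}"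
abbreviation "W\<^sub>B \<equiv> P_positions {a, b}"

lemma B_moves: "finite {a, b}" "0 \<notin> {a, b}"
  using a_pos a_less_b by auto

lemma nim_B_periodic: "G\<^sub>B (x + (a + b)) = G\<^sub>B x"
proof (rule nim_value_periodicI [OF B_moves])
  fix x s assume s: "s \<in> {a, b}" "x < s"
  then consider "s = a" "x + (a + b) - s = x + b" | "s = b" "x + (a + b) - s = x + a"
    by auto
  then show "G\<^sub>B (x + (a + b) - s) \<noteq> G\<^sub>B x"
    by cases (use nim_value_add_neq [OF B_moves] in auto)
qed auto

lemma nim_B_below: "x < b \<Longrightarrow> G\<^sub>B x = x div a mod 2"
proof (induction x rule: less_induct)
  case (less x)
  show ?case
  proof (cases "a \<le> x")
    case False
    then show ?thesis
      using less.prems by (auto intro!: nim_value_eqI [OF B_moves(2)])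
  next
    case True
    then have eq: "x div a = Suc ((x - a) div a)"
      using a_pos le_div_geq by blast
    have IH: "G\<^sub>B (x - a) = (x - a) div a mod 2"
      using less True a_pos by simp
    show ?thesis
      by (rule nim_value_eqI [OF B_moves(2)])
        (use True less.prems in \<open>auto simp: IH eq mod_Suc split: if_splits\<close>)
  qed
qed

text \<open>The option \<open>x - b\<close> lies in \<open>[0, a)\<close> and has value 0, so no
  P-position occurs here; the option \<open>x - a\<close> decides between 1 and 2.\<close>

lemma nim_B_last:
  assumes "b \<le> x" "x < a + b"
  shows "G\<^sub>B x = (if odd (x div a) then 1 else 2)"
proof -
  have "G\<^sub>B (x - b) = 0"
    using nim_B_below [of "x - b"] assms a_less_b by simp
  moreover have "G\<^sub>B (x - a) = (x - a) div a mod 2"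
    using nim_B_below [of "x - a"] assms a_less_b by simp
  moreover have "x div a = Suc ((x - a) div a)"
    using a_pos le_div_geq assms a_less_b by simp
  ultimately show ?thesis
    using assms a_less_b
    by (intro nim_value_eqI [OF B_moves(2)])
      (auto simp: mod_Suc less_2_cases_iff mod2_eq_if split: if_splits)
qed

lemma P_positions_B_iff:
  "x \<in> W\<^sub>B \<longleftrightarrow> x mod (a + b) < b \<and> even (x mod (a + b) div a)"
proof -
  let ?r = "x mod (a + b)"
  have "G\<^sub>B x = G\<^sub>B ?r"
    using periodic_mod [of "G\<^sub>B" "a + b"] nim_B_periodic by simp
  moreover have "?r < a + b"
    using a_pos by simp
  ultimately show ?thesis
    using nim_B_below [of ?r] nim_B_last [of ?r]
    by (cases "?r < b") (auto simp: P_positions_def mod2_eq_if)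
qed

lemma P_positions_B_mod: "x mod (a + b) \<in> W\<^sub>B \<longleftrightarrow> x \<in> W\<^sub>B"
  by (simp add: P_positions_B_iff)

lemma P_positions_B_cong:
  assumes "x mod (a + b) = y mod (a + b)"
  shows "x \<in> W\<^sub>B \<longleftrightarrow> y \<in> W\<^sub>B"
  using assms by (simp add: P_positions_B_iff)

lemma P_positions_B_below: "x < b \<Longrightarrow> x \<in> W\<^sub>B \<longleftrightarrow> even (x div a)"
  by (simp add: P_positions_B_iff)

lemma P_positions_B_initial: "x < a \<Longrightarrow> x \<in> W\<^sub>B"
  using a_less_b by (simp add: P_positions_B_below)

lemma P_positions_B_option:
  assumes "s \<in> {a, b}" "x \<in> W\<^sub>B"
  shows "x + s \<notin> W\<^sub>B"
  using nim_value_add_neq [OF B_moves assms(1), of x] assms(2) by (auto simp: P_positions_def)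

lemma mod_in_Z_set: "x mod (a + b) \<in> Z_set a b \<longleftrightarrow> x \<in> W\<^sub>B"
  using a_pos by (auto simp: Z_set_def P_positions_B_mod)

lemma D_set_iff: "x \<in> D_set a b \<longleftrightarrow> a \<le> x \<and> x < b \<and> odd (x div a)"
  by (auto simp: D_set_def Z_set_def P_positions_B_below)

text \<open>The interval \<open>[b - a, b)\<close> has length \<open>a\<close> and lies in the
  blocks of index \<open>\<eta>\<close> and \<open>\<eta> + 1\<close>; \<open>\<Lambda>\<close> is
  its part in the block of odd index.\<close>

lemma Lambda_setI:
  assumes "b - a \<le> y" "y < b" "odd (y div a)"
  shows "y \<in> Lambda_set a b"
proof -
  define \<eta> where "\<eta> = (b - a) div a"
  define \<epsilon> where "\<epsilon> = (b - a) mod a"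
  have \<epsilon>: "\<epsilon> < a" "b = \<eta> * a + \<epsilon> + a"
    using a_pos a_less_b by (auto simp: \<eta>_def \<epsilon>_def)
  have lo: "\<eta> * a + \<epsilon> \<le> y" and hi: "y < \<eta> * a + \<epsilon> + a"
    using assms \<epsilon> by auto
  have "y \<in> (if even \<eta> then {(\<eta> + 1) * a..<(\<eta> + 1) * a + \<epsilon>} else {\<eta> * a + \<epsilon>..<(\<eta> + 1) * a})"
  proof (cases "y < (\<eta> + 1) * a")
    case True
    then have "y div a = \<eta>"
      using lo by (intro div_nat_eqI) (auto simp: algebra_simps)
    then show ?thesis
      using assms(3) lo True by simp
  next
    case False
    then have "y div a = \<eta> + 1"
      using hi \<epsilon> by (intro div_nat_eqI) (auto simp: algebra_simps)
    then show ?thesis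
      using assms(3) hi False by simp
  qed
  then show ?thesis
    unfolding Lambda_set_def Let_def \<eta>_def \<epsilon>_def .
qed

text \<open>On the circle, \<open>\<Lambda>\<close> consists of the \<open>x\<close> such that neither \<open>x\<close> nor \<open>x + a = x - b\<close>
  is a P-position.\<close>

lemma mod_in_Lambda_set:
  assumes "x \<notin> W\<^sub>B" "x + a \<notin> W\<^sub>B"
  shows "x mod (a + b) \<in> Lambda_set a b"
proof -
  define r where "r = x mod (a + b)"
  have r: "r < a + b"
    using a_pos by (simp add: r_def)
  have "r \<notin> W\<^sub>B" "r + a \<notin> W\<^sub>B"
    using assms P_positions_B_cong [of r x] P_positions_B_cong [of "r + a" "x + a"]
    by (auto simp: r_def mod_add_left_eq)
  \<comment> \<open>On \<open>[b, a + b)\<close> the shift by \<open>a\<close> wraps round into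
    \<open>[0, a)\<close>, which consists of P-positions.\<close>
  have "r < b"
  proof (rule ccontr)
    assume "\<not> r < b"
    then have "(r + a) mod (a + b) = (r - b) mod (a + b)"
      using mod_add_self2 [of "r - b" "a + b"] by (simp add: add.commute)
    then show False
      using P_positions_B_cong P_positions_B_initial [of "r - b"] \<open>r + a \<notin> W\<^sub>B\<close> r \<open>\<not> r < b\<close>
      by (metis add.commute less_diff_conv2 not_less)
  qed
  then have odd: "odd (r div a)"
    using \<open>r \<notin> W\<^sub>B\<close> P_positions_B_below by blast
  \<comment> \<open>The next block has even index, so \<open>r + a\<close> can fail to be a
    P-position only by leaving \<open>[0, b)\<close>.\<close>
  then have "even ((r + a) div a)"
    using a_pos by (simp add: div_add_self2)
  then have "b \<le> r + a"
    using \<open>r + a \<notin> W\<^sub>B\<close> P_positions_B_below not_less by blast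
  then show ?thesis
    using Lambda_setI [of r] \<open>r < b\<close> odd by (simp add: r_def)
qed

section \<open>Admissibility transferred from the circle to integers\<close>

lemma mod_in_translate_mod:
  assumes "x mod m \<in> A"
  shows "(x + c) mod m \<in> translate_mod m (int (c mod m)) A"
proof -
  have "(x + c) mod m = nat ((int (x mod m) + int (c mod m)) mod int m)"
    by (simp flip: of_nat_add of_nat_mod add: mod_add_eq)
  then show ?thesis
    using assms unfolding translate_mod_def by blast
qed

text \<open>\<open>W\<^sub>B\<close> is a union of residue classes modulo \<open>a + b\<close>, so
  disjointness on the circle lifts to all naturals.\<close>

lemma Theta_ab_iff:
  "c mod (a + b) \<in> Theta_ab a b \<longleftrightarrow> (\<forall>x. x \<in> W\<^sub>B \<longrightarrow> x + c \<notin> W\<^sub>B)"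
proof
  assume *: "c mod (a + b) \<in> Theta_ab a b"
  show "\<forall>x. x \<in> W\<^sub>B \<longrightarrow> x + c \<notin> W\<^sub>B"
  proof (intro allI impI notI)
    fix x assume "x \<in> W\<^sub>B" "x + c \<in> W\<^sub>B"
    then have "(x + c) mod (a + b) \<in> Z_set a b \<inter> translate_mod (a + b) (int (c mod (a + b))) (Z_set a b)"
      using mod_in_translate_mod mod_in_Z_set by blast
    then show False
      using * by (auto simp: Theta_ab_def)
  qed
next
  assume *: "\<forall>x. x \<in> W\<^sub>B \<longrightarrow> x + c \<notin> W\<^sub>B"
  have "False" if "x \<in> Z_set a b" "nat ((int x + int (c mod (a + b))) mod int (a + b)) \<in> Z_set a b" for x
  proof -
    have "nat ((int x + int (c mod (a + b))) mod int (a + b)) = (x + c) mod (a + b)"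
      by (simp flip: of_nat_add of_nat_mod add: mod_add_right_eq)
    then have "x + c \<in> W\<^sub>B"
      using that(2) mod_in_Z_set by metis
    then show False
      using that(1) * by (auto simp: Z_set_def)
  qed
  then show "c mod (a + b) \<in> Theta_ab a b"
    using a_pos by (auto simp: Theta_ab_def translate_mod_def)
qed

text \<open>\<open>x + c + a - b\<close> is the option of \<open>x + (c + a)\<close> by the move
  \<open>b\<close>; translating its residue by \<open>(b - a) - c\<close> leads back to
  \<open>x\<close>.\<close>

lemma Theta_caD:
  assumes "c mod (a + b) \<in> Theta_ca a b" "b \<le> c" "x < b - a" "x \<in> W\<^sub>B"
  shows "x + c + a - b \<notin> W\<^sub>B"
proof
  define y where "y = x + c + a - b"
  assume "x + c + a - b \<in> W\<^sub>B"
  then have "y mod (a + b) \<in> Z_set a b"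
    by (simp add: mod_in_Z_set y_def)
  moreover have "x = nat ((int (y mod (a + b)) + (int (b - a) - int (c mod (a + b)))) mod int (a + b))"
  proof -
    have "(int (y mod (a + b)) + (int (b - a) - int (c mod (a + b)))) mod int (a + b)
        = (int y + (int (b - a) - int c)) mod int (a + b)"
      unfolding zmod_int by (simp add: mod_add_left_eq mod_add_right_eq mod_diff_right_eq)
         (metis mod_add_cong mod_diff_right_eq mod_mod_trivial)
    also have "int y + (int (b - a) - int c) = int x"
      using assms a_less_b by (simp add: y_def of_nat_diff)
    also have "int x mod int (a + b) = int x"
      using assms(3) by simp
    finally show ?thesis
      by simp
  qed
  ultimately have "x \<in> translate_mod (a + b) (int (b - a) - int (c mod (a + b))) (Z_set a b)"
    unfolding translate_mod_def by blast
  moreover have "x \<in> Z_set a b"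
    using assms by (simp add: Z_set_def)
  ultimately show False
    using assms by (auto simp: Theta_ca_def)
qed

lemma Theta_cb_LambdaD:
  assumes "c mod (a + b) \<in> Theta_cb a b" "y \<in> Lambda_set a b" "y < b"
  shows "y + c \<notin> W\<^sub>B"
proof
  assume "y + c \<in> W\<^sub>B"
  then have "(y + c) mod (a + b) \<in> translate_mod (a + b) (int (c mod (a + b))) (Lambda_set a b) \<inter> Z_set a b"
    using mod_in_translate_mod [of y "a + b"] mod_in_Z_set assms by auto
  then show False
    using assms(1) by (auto simp: Theta_cb_def)
qed

lemma Theta_cb_DD:
  assumes "c mod (a + b) \<in> Theta_cb a b" "y \<in> D_set a b"
  shows "(y + c) mod (a + b) \<notin> Lambda_set a b"
proof
  assume "(y + c) mod (a + b) \<in> Lambda_set a b"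
  then have "(y + c) mod (a + b) \<in> translate_mod (a + b) (int (c mod (a + b))) (D_set a b) \<inter> Lambda_set a b"
    using mod_in_translate_mod [of y "a + b"] assms by (auto simp: D_set_def)
  then show False
    using assms(1) by (auto simp: Theta_cb_def)
qed

text \<open>A proper divisor \<open>p\<close> of \<open>Q\<close> as period would force \<open>p \<equiv> 2ja\<close> modulo \<open>a + b\<close>.  If
  \<open>j > 0\<close>, then the interval \<open>[b - 2ja, b - 2ja + a)\<close> contains a P-position \<open>z\<close>, and
  \<open>z + p\<close> falls into the gap \<open>[b, a + b)\<close> of \<open>\<Z>\<close>.\<close>

lemma proper_period:
  assumes period: "\<And>x. x + p \<in> W \<longleftrightarrow> x \<in> W"
    and "p dvd Q" "p < Q" "a + b \<le> Q"
    and below: "\<And>x. x < b \<Longrightarrow> x \<in> W \<longleftrightarrow> x \<in> W\<^sub>B"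
    and sub: "\<And>x. x < Q \<Longrightarrow> x \<in> W \<Longrightarrow> x \<in> W\<^sub>B"
    and gap: "\<And>x. Q - a \<le> x \<Longrightarrow> x < Q \<Longrightarrow> x \<notin> W"
  shows "a + b dvd p \<or> a dvd p \<and> a dvd b \<and> odd (b div a)"
proof -
  define r where "r = p mod (a + b)"
  have "p > 0"
    using assms(2,3) by (cases p) auto
  obtain k where k: "Q = k * p"
    using \<open>p dvd Q\<close> by (metis dvd_def mult.commute)
  have "k \<noteq> 0" "k \<noteq> 1"
    using k \<open>p < Q\<close> by auto
  then have "2 * p \<le> k * p"
    by (intro mult_right_mono) auto
  then have "2 * p \<le> Q"
    using k by simp
  have "0 \<in> W"
    using below P_positions_B_initial a_pos a_less_b by simp
  \<comment> \<open>\<open>Q - p\<close> is a multiple of \<open>p\<close>, hence in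
    \<open>W\<close> along with 0; the gap below \<open>Q\<close> then forces
    \<open>a < p\<close>.\<close>
  have "Q - p \<in> W"
  proof -
    have "0 + (k - 1) * p \<in> W"
      using periodic_mult [of "\<lambda>x. x \<in> W" p 0 "k - 1"] period \<open>0 \<in> W\<close> by simp
    then show ?thesis
      using k by (simp add: diff_mult_distrib)
  qed
  then have "a < p"
    using gap [of "Q - p"] \<open>p > 0\<close> \<open>p < Q\<close> by force
  have shifted: "r + x \<in> W\<^sub>B" if "x < a" for x
  proof -
    have "x + p \<in> W"
      using period below P_positions_B_initial that a_less_b by simp
    then have "x + p \<in> W\<^sub>B"
      using sub that \<open>a < p\<close> \<open>2 * p \<le> Q\<close> by simp
    moreover have "(x + p) mod (a + b) = (r + x) mod (a + b)"
      by (metis r_def mod_add_left_eq add.commute)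
    ultimately show ?thesis
      using P_positions_B_cong by blast
  qed
  have "r < b" "even (r div a)"
    using shifted [of 0] a_pos P_positions_B_iff [of r] by (auto simp: r_def)
  \<comment> \<open>Both ends of \<open>[r, r + a)\<close> lie below \<open>b\<close> in blocks of
    even index, so \<open>r\<close> starts a block.\<close>
  have "(r + a - 1) mod (a + b) = r + a - 1"
    using \<open>r < b\<close> by simp
  then have "r + a \<le> b" "even ((r + a - 1) div a)"
    using shifted [of "a - 1"] a_pos P_positions_B_iff [of "r + a - 1"] by auto
  then have "a dvd r"
    using even_div_interval a_pos \<open>even (r div a)\<close> by blast
  show ?thesis
  proof (cases "r = 0")
    case True
    then show ?thesis
      by (auto simp: r_def)
  next
    case False
    then have "a \<le> r"
      using \<open>a dvd r\<close> by (simp add: dvd_imp_le)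
    define u where "u = b - r"
    have u: "a \<le> u" "u + r = b"
      using \<open>r + a \<le> b\<close> by (auto simp: u_def)
    obtain q where q: "r = a * q" "even q"
      using \<open>a dvd r\<close> \<open>even (r div a)\<close> a_pos by auto
    have div_u: "b div a = u div a + q"
      using q u a_pos by (metis div_mult_self2 add.commute not_less_zero mult.commute)
    have no_witness: False if z: "u \<le> z" "z < u + a" "even (z div a)" for z
    proof -
      have "z < b"
        using z u \<open>a \<le> r\<close> by linarith
      then have "z + p \<in> W"
        using z below P_positions_B_below period by simp
      moreover have "z + p < Q"
      proof (cases "p < a + b")
        case True
        then have "p = r"
          by (simp add: r_def)
        then show ?thesis
          using z u \<open>a + b \<le> Q\<close> by simp
      next
        case False
        then show ?thesis
          using \<open>z < b\<close> \<open>2 * p \<le> Q\<close> by simp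
      qed
      ultimately have "z + p \<in> W\<^sub>B"
        using sub by blast
      then have "z + r \<in> W\<^sub>B"
        using P_positions_B_cong [of "z + p" "z + r"] by (simp add: r_def mod_add_right_eq)
      then show False
        using z u P_positions_B_iff [of "z + r"] by simp
    qed
    have "odd (u div a)"
      using no_witness [of u] a_pos by auto
    \<comment> \<open>Otherwise the first multiple of \<open>a\<close> after \<open>u\<close> lies
      in \<open>[u, u + a)\<close> and starts a block of even index.\<close>
    have "a dvd u"
    proof (rule ccontr)
      assume "\<not> a dvd u"
      moreover define v s where "v = u div a" and "s = u mod a"
      ultimately have "u = v * a + s" "0 < s" "s < a"
        using a_pos by (auto simp: dvd_eq_mod_eq_0)
      then have "u \<le> (v + 1) * a" "(v + 1) * a < u + a"
        by (auto simp: algebra_simps)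
      then show False
        using no_witness [of "(v + 1) * a"] \<open>odd (u div a)\<close> a_pos
        by (simp add: v_def del: mult_Suc)
    qed
    then have "a dvd b"
      using u \<open>a dvd r\<close> by (metis dvd_add)
    moreover have "odd (b div a)"
      using div_u \<open>odd (u div a)\<close> q by simp
    moreover have "a dvd p"
    proof -
      have "a dvd (p div (a + b)) * (a + b) + r"
        using \<open>a dvd b\<close> \<open>a dvd r\<close> by simp
      then show ?thesis
        by (simp only: r_def div_mult_mod_eq)
    qed
    ultimately show ?thesis
      by blast
  qed
qed

text \<open>Here \<open>a + b\<close> is an even multiple of \<open>a\<close> and
  \<open>[b, a + b)\<close> is a block of odd index, so the P-positions of \<open>B\<close> are
  exactly the blocks of even index. Since \<open>[c, c + a)\<close> avoids them, it is a single
  block.\<close>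

lemma Theta_ab_imp_dvd:
  assumes "c mod (a + b) \<in> Theta_ab a b" "a dvd b" "odd (b div a)"
  shows "a dvd c"
proof -
  have dbl: "2 * a dvd a + b"
  proof -
    obtain k where "b = a * k" "odd k"
      using assms a_pos by auto
    then show ?thesis
      by (auto elim!: oddE simp: algebra_simps)
  qed
  have free: "odd ((x + c) div a)" if "x < a" for x
  proof (rule ccontr)
    assume ev: "\<not> odd ((x + c) div a)"
    define r where "r = (x + c) mod (a + b)"
    have "x + c \<notin> W\<^sub>B"
      using assms(1) that Theta_ab_iff P_positions_B_initial by blast
    moreover have "even (r div a)"
    proof -
      obtain k where k: "a + b = 2 * a * k"
        using dbl by blast
      have "x + c = r + a * (2 * k * ((x + c) div (a + b)))"
        by (metis (no_types, lifting) k r_def mod_mult_div_eq mult.assoc mult.commute)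
      then have "(x + c) div a = r div a + 2 * k * ((x + c) div (a + b))"
        using a_pos by (metis div_mult_self2 add.commute not_less_zero)
      then show ?thesis
        using ev by simp
    qed
    ultimately have "b \<le> r"
      using P_positions_B_iff [of "x + c"] by (auto simp: r_def not_less)
    moreover have "r < a + b"
      using a_pos by (simp add: r_def)
    moreover obtain k where "b = a * k" "odd k"
      using assms a_pos by auto
    ultimately have "r div a = k"
      by (intro div_nat_eqI) (auto simp: algebra_simps)
    then show False
      using \<open>even (r div a)\<close> \<open>odd k\<close> by simp
  qed
  \<comment> \<open>Adding \<open>a\<close> turns the odd indices into the even ones that
    \<open>even_div_interval\<close> asks for.\<close>
  have "a dvd c + a"
  proof (rule even_div_interval [OF a_pos])
    show "even ((c + a) div a)"
      using free [of 0] a_pos by (simp add: div_add_self2)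
    have "(c + a + a - 1) div a = (a - 1 + c) div a + 1"
      using a_pos div_add_self2 [of a "a - 1 + c"] by (simp add: ac_simps)
    then show "even ((c + a + a - 1) div a)"
      using free [of "a - 1"] a_pos by simp
  qed
  then show ?thesis
    by simp
qed

end

section \<open>The game with three moves\<close>

locale three_moves = two_moves +
  fixes c :: nat
  assumes b_less_c: "b < c"
begin

abbreviation "G\<^sub>S \<equiv> nim_value {a, b, c}"
abbreviation "W\<^sub>S \<equiv> P_positions {a, b, c}"

lemma S_moves: "finite {a, b, c}" "0 \<notin> {a, b, c}"
  using a_pos a_less_b b_less_c by auto

lemma nim_S_add_neq: "s \<in> {a, b, c} \<Longrightarrow> G\<^sub>S (x + s) \<noteq> G\<^sub>S x"
  using nim_value_add_neq [OF S_moves] .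

lemma nim_S_one: "G\<^sub>S x = 1 \<Longrightarrow> a \<le> x \<and> G\<^sub>S (x - a) = 0"
  by (rule nim_value_one_imp_zero [OF S_moves]) (use a_less_b b_less_c in auto)

lemma nim_S_below: "x < c \<Longrightarrow> G\<^sub>S x = G\<^sub>B x"
proof (induction x rule: less_induct)
  case (less x)
  have IH: "G\<^sub>S (x - s) = G\<^sub>B (x - s)" if "s \<in> {a, b}" "s \<le> x" for s
    using less that a_pos a_less_b by auto
  show ?case
  proof (rule nim_value_eqI [OF S_moves(2)])
    fix s assume "s \<in> {a, b, c}" "s \<le> x"
    then show "G\<^sub>S (x - s) \<noteq> G\<^sub>B x"
      using less.prems IH nim_value_option_neq [OF B_moves, of s x] by auto
  next
    fix m assume "m < G\<^sub>B x"
    then show "\<exists>s\<in>{a, b, c}. s \<le> x \<and> G\<^sub>S (x - s) = m"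
      using less_nim_valueD [OF B_moves(2), of m x] IH by (metis insert_iff)
  qed
qed

lemma P_positions_S_below: "x < c \<Longrightarrow> x \<in> W\<^sub>S \<longleftrightarrow> x \<in> W\<^sub>B"
  by (simp add: P_positions_def nim_S_below)

lemma P_positions_S_add_c: "x \<in> W\<^sub>S \<Longrightarrow> x + c \<notin> W\<^sub>S"
  using nim_S_add_neq [of c x] by (auto simp: P_positions_def)

lemma P_positions_S_first_gap: "x < a \<Longrightarrow> x + c \<notin> W\<^sub>S"
  using P_positions_S_add_c P_positions_S_below P_positions_B_initial a_less_b b_less_c by simp

text \<open>The move \<open>c\<close> never joins positions of equal value in the game \<open>B\<close>: value \<open>1\<close> is value \<open>0\<close>
  shifted by \<open>a\<close>, and the positions of value \<open>2\<close> lie in \<open>[b, a + b)\<close>, so \<open>c\<close> joining two of them would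
  also join two points of \<open>[0, a)\<close> on the circle.\<close>

lemma nim_S_eq_nim_B:
  assumes "c mod (a + b) \<in> Theta_ab a b"
  shows "G\<^sub>S x = G\<^sub>B x"
proof -
  have free: "x \<in> W\<^sub>B \<Longrightarrow> x + c \<notin> W\<^sub>B" for x
    using assms Theta_ab_iff by blast
  have one: "a \<le> x \<and> G\<^sub>B (x - a) = 0" if "G\<^sub>B x = 1" for x
    by (rule nim_value_one_imp_zero [OF B_moves]) (use a_less_b that in auto)
  have two: "b \<le> x mod (a + b)" if "G\<^sub>B x \<noteq> 0" "G\<^sub>B x \<noteq> 1" for x
  proof (rule ccontr)
    assume "\<not> ?thesis"
    then have "G\<^sub>B (x mod (a + b)) = x mod (a + b) div a mod 2"
      using nim_B_below by simp
    then show False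
      using that periodic_mod [of "G\<^sub>B" "a + b" x] nim_B_periodic
      by (metis not_mod_2_eq_1_eq_0)
  qed
  have neq: "G\<^sub>B (x + c) \<noteq> G\<^sub>B x" for x
  proof
    assume eq: "G\<^sub>B (x + c) = G\<^sub>B x"
    consider "G\<^sub>B x = 0" | "G\<^sub>B x = 1" | "G\<^sub>B x \<noteq> 0" "G\<^sub>B x \<noteq> 1"
      by blast
    then show False
    proof cases
      case 1
      then show False
        using free [of x] eq by (simp add: P_positions_def)
    next
      case 2
      then show False
        using free [of "x - a"] one [of x] one [of "x + c"] eq by (simp add: P_positions_def)
    next
      case 3
      define r where "r = x mod (a + b)"
      define s where "s = (x + c) mod (a + b)"
      have rs: "b \<le> r" "b \<le> s" "r < a + b" "s < a + b"
        using two [of x] two [of "x + c"] 3 eq a_pos by (auto simp: r_def s_def)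
      \<comment> \<open>Adding \<open>a + b - t\<close> subtracts the smaller residue on the circle
        without leaving the naturals; both residues then fall below \<open>a\<close>.\<close>
      define t where "t = min r s"
      define z where "z = x + (a + b - t)"
      have "z mod (a + b) = (r - t) mod (a + b)"
      proof -
        have "z mod (a + b) = (r + (a + b - t)) mod (a + b)"
          by (simp add: z_def r_def mod_add_left_eq)
        also have "r + (a + b - t) = r - t + (a + b)"
          using rs by (simp add: t_def)
        finally show ?thesis
          by simp
      qed
      moreover have "(z + c) mod (a + b) = (s - t) mod (a + b)"
      proof -
        have "z + c = x + c + (a + b - t)"
          by (simp add: z_def)
        then have "(z + c) mod (a + b) = (s + (a + b - t)) mod (a + b)"
          by (simp only: s_def mod_add_left_eq)
        also have "s + (a + b - t) = s - t + (a + b)"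
          using rs by (simp add: t_def)
        finally show ?thesis
          by simp
      qed
      moreover have "r - t < a" "s - t < a"
        using rs by (auto simp: t_def)
      ultimately have "z \<in> W\<^sub>B" "z + c \<in> W\<^sub>B"
        using P_positions_B_cong P_positions_B_initial by blast+
      then show False
        using free by blast
    qed
  qed
  show ?thesis
  proof (induction x rule: less_induct)
    case (less x)
    have IH: "G\<^sub>S (x - s) = G\<^sub>B (x - s)" if "s \<in> {a, b, c}" "s \<le> x" for s
    proof -
      have "0 < s"
        using that S_moves(2) by (cases s) auto
      then show ?thesis
        using less that by auto
    qed
    show ?case
    proof (rule nim_value_eqI [OF S_moves(2)])
      fix s assume "s \<in> {a, b, c}" "s \<le> x"
      then show "G\<^sub>S (x - s) \<noteq> G\<^sub>B x"
        using IH neq [of "x - c"] nim_value_option_neq [OF B_moves, of s x] by auto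
    next
      fix m assume "m < G\<^sub>B x"
      then show "\<exists>s\<in>{a, b, c}. s \<le> x \<and> G\<^sub>S (x - s) = m"
        using less_nim_valueD [OF B_moves(2), of m x] IH by (metis insert_iff)
    qed
  qed
qed

section \<open>The period \<open>c + a\<close>\<close>

lemma nim_S_periodic_ca:
  assumes "c mod (a + b) \<in> Theta_ca a b"
  shows "G\<^sub>S (x + (c + a)) = G\<^sub>S x"
proof (rule nim_value_periodicI [OF S_moves])
  \<comment> \<open>For \<open>x < b - a\<close> admissibility applies; on \<open>[b - a, b)\<close>
    the option by \<open>b\<close> falls into \<open>[c, c + a)\<close>, which has no
    P-positions.\<close>
  have zero: "G\<^sub>S (x + (c + a) - b) \<noteq> 0" if "x < b" "G\<^sub>S x = 0" for x
  proof (cases "x < b - a")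
    case True
    have "x \<in> W\<^sub>B"
      using that b_less_c P_positions_S_below [of x] by (simp add: P_positions_def)
    then have "x + c + a - b \<notin> W\<^sub>B"
      using Theta_caD assms True b_less_c by simp
    then show ?thesis
      using P_positions_S_below [of "x + (c + a) - b"] True b_less_c
      by (simp add: P_positions_def add.assoc less_diff_conv2)
  next
    case False
    then have "x + (c + a) - b = (x + a - b) + c" "x + a - b < a"
      using that a_less_b by auto
    then show ?thesis
      using P_positions_S_first_gap [of "x + a - b"] by (simp add: P_positions_def)
  qed
  fix x s assume s: "s \<in> {a, b, c}" "x < s"
  then consider "x + (c + a) - s = x + c" | "x + (c + a) - s = x + a" | "s = b"
    by auto
  then show "G\<^sub>S (x + (c + a) - s) \<noteq> G\<^sub>S x"
  proof cases
    case 3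
    have "G\<^sub>S x = x div a mod 2"
      using s 3 b_less_c nim_S_below nim_B_below by simp
    then consider "G\<^sub>S x = 0" | "G\<^sub>S x = 1"
      by (metis not_mod_2_eq_1_eq_0)
    then show ?thesis
    proof cases
      case 1
      then show ?thesis
        using zero s 3 by simp
    next
      \<comment> \<open>Pairing moves both positions of value 1 down by \<open>a\<close> to value 0,
        where \<open>zero\<close> applies.\<close>
      case 2
      show ?thesis
      proof
        assume "G\<^sub>S (x + (c + a) - s) = G\<^sub>S x"
        then have "G\<^sub>S (x + (c + a) - b - a) = 0"
          using nim_S_one [of "x + (c + a) - b"] 2 3 by (simp only:)
        moreover have "a \<le> x" "G\<^sub>S (x - a) = 0"
          using nim_S_one 2 by auto
        moreover from this have "x + (c + a) - b - a = x - a + (c + a) - b"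
          by simp
        ultimately show False
          using zero [of "x - a"] s(2) 3 by (metis le_less_trans diff_le_self)
      qed
    qed
  qed (use nim_S_add_neq in auto)
qed (use a_less_b b_less_c in auto)

section \<open>The period \<open>c + b\<close>\<close>

text \<open>For \<open>y\<close> in \<open>D\<close>, the options \<open>y\<close> and
  \<open>y + c - a\<close> of \<open>y + c\<close> are not P-positions, the latter because
  \<open>y - a\<close> is one; so \<open>y + c - b\<close> decides. It lies below \<open>c\<close>,
  where \<open>S\<close> and \<open>B\<close> agree. As \<open>y + c\<close> avoids
  \<open>\<Lambda>\<close> on the circle, exactly one of \<open>y + c\<close> and
  \<open>y + c - b\<close> is a P-position of \<open>B\<close>.\<close>

lemma P_positions_S_add_c_iff:
  assumes "c mod (a + b) \<in> Theta_cb a b" "y < b"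
  shows "y + c \<in> W\<^sub>S \<longleftrightarrow> y + c \<in> W\<^sub>B \<and> y \<notin> W\<^sub>B"
proof (cases "y \<in> W\<^sub>B")
  case True
  then show ?thesis
    using P_positions_S_add_c P_positions_S_below assms b_less_c by simp
next
  case False
  then have odd: "odd (y div a)"
    using P_positions_B_below assms by blast
  have "a \<le> y"
    using False P_positions_B_initial not_less by blast
  then have "y \<in> D_set a b"
    using D_set_iff odd assms by blast
  then have Lam: "(y + c) mod (a + b) \<notin> Lambda_set a b"
    using Theta_cb_DD assms by blast
  have "y + c \<in> W\<^sub>B \<longleftrightarrow> y + c - b \<notin> W\<^sub>B"
  proof -
    have "(y + c + a) mod (a + b) = (y + c - b) mod (a + b)"
      using b_less_c mod_add_self2 [of "y + c - b" "a + b"] by (simp add: add.commute add.left_commute)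
    then have "y + c + a \<in> W\<^sub>B \<longleftrightarrow> y + c - b \<in> W\<^sub>B"
      by (rule P_positions_B_cong)
    then show ?thesis
      using Lam mod_in_Lambda_set [of "y + c"] P_positions_B_option [of a "y + c"] by auto
  qed
  also have "\<dots> \<longleftrightarrow> y + c - b \<notin> W\<^sub>S"
    using P_positions_S_below [of "y + c - b"] assms b_less_c by simp
  also have "\<dots> \<longleftrightarrow> y + c \<in> W\<^sub>S"
  proof
    assume b: "y + c - b \<notin> W\<^sub>S"
    have "y - a \<in> W\<^sub>S"
    proof -
      have "even ((y - a) div a)"
        using odd \<open>a \<le> y\<close> a_pos le_div_geq [of a y] by simp
      then show ?thesis
        using P_positions_S_below P_positions_B_below assms b_less_c by simp
    qed
    then have a: "y + c - a \<notin> W\<^sub>S"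
      using P_positions_S_add_c [of "y - a"] \<open>a \<le> y\<close> by simp
    have "y \<notin> W\<^sub>S"
      using False P_positions_S_below assms b_less_c by simp
    then have "G\<^sub>S (y + c) = 0"
      by (intro nim_value_eqI [OF S_moves(2)]) (use a b in \<open>auto simp: P_positions_def\<close>)
    then show "y + c \<in> W\<^sub>S"
      by (simp add: P_positions_def)
  next
    assume "y + c \<in> W\<^sub>S"
    then show "y + c - b \<notin> W\<^sub>S"
      using nim_value_option_neq [OF S_moves, of b "y + c"] b_less_c by (simp add: P_positions_def)
  qed
  finally show ?thesis
    using False by blast
qed

text \<open>A P-position \<open>y + c\<close> would need \<open>y\<close> outside
  \<open>W\<^sub>B\<close>, hence in \<open>\<Lambda>\<close>, whose translate by \<open>c\<close>
  misses \<open>W\<^sub>B\<close>.\<close>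

lemma P_positions_S_last_gap:
  assumes "c mod (a + b) \<in> Theta_cb a b" "b - a \<le> y" "y < b"
  shows "y + c \<notin> W\<^sub>S"
  using P_positions_S_add_c_iff Theta_cb_LambdaD Lambda_setI P_positions_B_below assms by blast

lemma nim_S_periodic_cb:
  assumes "c mod (a + b) \<in> Theta_cb a b"
  shows "G\<^sub>S (x + (c + b)) = G\<^sub>S x"
proof (rule nim_value_periodicI [OF S_moves])
  fix x s assume s: "s \<in> {a, b, c}" "x < s"
  then consider "x + (c + b) - s = x + c" | "x + (c + b) - s = x + b" | "s = a"
    by auto
  then show "G\<^sub>S (x + (c + b) - s) \<noteq> G\<^sub>S x"
  proof cases
    \<comment> \<open>Since \<open>x < a\<close>, the value of \<open>x\<close> is 0, and the new
      option is \<open>c\<close> plus a point of \<open>[b - a, b)\<close>.\<close>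
    case 3
    have "x \<in> W\<^sub>S"
      using s 3 P_positions_S_below P_positions_B_initial a_less_b b_less_c by simp
    moreover have "x + (c + b) - s = x + b - a + c"
      using s 3 a_less_b by simp
    moreover have "x + b - a + c \<notin> W\<^sub>S"
      using P_positions_S_last_gap [of "x + b - a"] assms s 3 a_less_b by simp
    ultimately show ?thesis
      by (simp add: P_positions_def)
  qed (use nim_S_add_neq in auto)
qed (use a_less_b b_less_c in auto)

section \<open>Shape of the P-positions and minimality of the period\<close>

lemma P_positions_S_eq_T_set:
  assumes period: "\<And>x. G\<^sub>S (x + Q) = G\<^sub>S x" and "c \<le> Q"
    and above: "\<And>y. y + c < Q \<Longrightarrow> y + c \<in> W\<^sub>S \<longleftrightarrow> y + c \<in> W\<^sub>B \<and> y \<notin> W\<^sub>B"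
  shows "W\<^sub>S = T_set a b c Q"
proof (rule set_eqI)
  fix x
  have "x mod Q < Q"
    using assms(2) b_less_c by simp
  have "x \<in> W\<^sub>S \<longleftrightarrow> x mod Q \<in> W\<^sub>S"
    using periodic_mod [of "G\<^sub>S" Q x] period by (simp add: P_positions_def)
  also have "\<dots> \<longleftrightarrow> x \<in> T_set a b c Q"
  proof (cases "x mod Q < c")
    case True
    then show ?thesis
      by (simp add: P_positions_S_below T_set_def)
  next
    case False
    then show ?thesis
      using above [of "x mod Q - c"] \<open>x mod Q < Q\<close> by (simp add: T_set_def)
  qed
  finally show "x \<in> W\<^sub>S \<longleftrightarrow> x \<in> T_set a b c Q" .
qed

text \<open>Both alternatives of \<open>proper_period\<close> pass from a divisor to
  \<open>Q\<close>, where the last two hypotheses exclude them.\<close>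

lemma least_period_S:
  assumes period: "is_period G\<^sub>S Q" and "a + b \<le> Q"
    and sub: "\<And>x. x < Q \<Longrightarrow> x \<in> W\<^sub>S \<Longrightarrow> x \<in> W\<^sub>B"
    and gap: "\<And>x. Q - a \<le> x \<Longrightarrow> x < Q \<Longrightarrow> x \<notin> W\<^sub>S"
    and "Q = a + b \<or> \<not> a + b dvd Q"
    and "\<not> (a dvd Q \<and> a dvd b \<and> odd (b div a))"
  shows "least_period G\<^sub>S = Q"
proof (rule ccontr)
  define p where "p = least_period G\<^sub>S"
  assume "least_period G\<^sub>S \<noteq> Q"
  have "p dvd Q"
    using least_period_dvd [OF period] by (simp add: p_def)
  moreover have "Q > 0"
    using period by (simp add: is_period_def)
  ultimately have "p \<le> Q"
    by (rule dvd_imp_le)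
  then have "p < Q"
    using \<open>least_period G\<^sub>S \<noteq> Q\<close> by (simp add: p_def)
  have p: "1 \<le> p" "\<And>x. G\<^sub>S (x + p) = G\<^sub>S x"
    using is_period_least_period [OF period] by (auto simp: p_def is_period_def)
  have "a + b dvd p \<or> a dvd p \<and> a dvd b \<and> odd (b div a)"
    by (rule proper_period [where W = "W\<^sub>S" and Q = Q])
      (use p \<open>p dvd Q\<close> \<open>p < Q\<close> assms P_positions_S_below b_less_c in \<open>auto simp: P_positions_def\<close>)
  then show False
  proof (elim disjE conjE)
    assume "a + b dvd p"
    then have "a + b dvd Q" "a + b \<le> p"
      using \<open>p dvd Q\<close> p(1) by (auto intro: dvd_trans dvd_imp_le)
    then show False
      using assms(5) \<open>p < Q\<close> by auto
  next
    assume "a dvd p" "a dvd b" "odd (b div a)"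
    then show False
      using assms(6) \<open>p dvd Q\<close> dvd_trans by blast
  qed
qed

text \<open>As \<open>c\<close> is congruent to \<open>-s\<close>, the move \<open>s\<close> would
  join any two P-positions of \<open>B\<close> that \<open>c\<close> joins. Outside the first case
  this keeps \<open>a + b\<close> from dividing \<open>P\<close>.\<close>

lemma Theta_ab_if_dvd:
  assumes "s \<in> {a, b}" "a + b dvd c + s"
  shows "c mod (a + b) \<in> Theta_ab a b"
  unfolding Theta_ab_iff
proof (intro allI impI notI)
  fix x assume "x \<in> W\<^sub>B" "x + c \<in> W\<^sub>B"
  then have "x + c + s \<notin> W\<^sub>B"
    using P_positions_B_option assms(1) by blast
  moreover have "(x + c + s) mod (a + b) = x mod (a + b)"
    using assms(2) by (metis add.assoc add.right_neutral dvd_eq_mod_eq_0 mod_add_right_eq)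
  ultimately show False
    using P_positions_B_cong \<open>x \<in> W\<^sub>B\<close> by blast
qed

end

theorem theorem34:
  fixes a b c \<rho> P :: nat and S B :: "nat set"
  assumes "2 \<le> a" and "a < b" and "b < c"
    and "Gcd {a, b, c} = 1"
    and "c \<noteq> a + b"
    and "S = {a, b, c}" and "B = {a, b}"
    and "\<rho> = c mod (a + b)"
    and "\<rho> \<in> Theta_ab a b \<union> Theta_ca a b \<union> Theta_cb a b"
    and "P = (LEAST p. admissible_period a b c \<rho> p)"
  shows "purely_periodic (nim_value S) \<and>
    least_period (nim_value S) = P \<and>
    P_positions S =
      (if \<rho> \<in> Theta_ab a b then P_positions B else T_set a b c P)"
proof -
  interpret three_moves a b c
    by unfold_locales (use assms in auto)
  have gcd: "\<not> (a dvd b \<and> a dvd c)"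
  proof
    assume "a dvd b \<and> a dvd c"
    then have "a dvd Gcd {a, b, c}"
      by (intro Gcd_greatest) auto
    then show False
      using assms(1,4) by simp
  qed
  have \<rho>: "\<rho> = c mod (a + b)"
    by fact
  consider (ab) "\<rho> \<in> Theta_ab a b" | (ca) "\<rho> \<notin> Theta_ab a b" "\<rho> \<in> Theta_ca a b"
    | (cb) "\<rho> \<notin> Theta_ab a b" "\<rho> \<notin> Theta_ca a b" "\<rho> \<in> Theta_cb a b"
    using assms(9) by blast
  then show ?thesis
  proof cases
    case ab
    \<comment> \<open>The candidates are ordered \<open>a + b < c + a < c + b\<close>, so the first
      admissible one in this order is the least.\<close>
    have P: "P = a + b"
      unfolding assms(10)
      by (rule Least_equality) (use ab assms(2,3) in \<open>auto simp: admissible_period_def\<close>)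
    have eq: "G\<^sub>S = G\<^sub>B"
      using nim_S_eq_nim_B ab \<rho> by blast
    then have W: "W\<^sub>S = W\<^sub>B"
      by (simp add: P_positions_def)
    have period: "is_period G\<^sub>S P"
      using nim_B_periodic a_pos by (simp add: is_period_def eq P)
    have "least_period G\<^sub>S = P"
    proof (rule least_period_S [OF period])
      show "\<not> (a dvd P \<and> a dvd b \<and> odd (b div a))"
        using gcd Theta_ab_imp_dvd ab \<rho> by blast
    \<comment> \<open>The gap required below \<open>P\<close> is \<open>[b, a + b)\<close>, where
      \<open>B\<close> has no P-positions.\<close>
    qed (auto simp: P W P_positions_B_iff)
    then show ?thesis
      using period ab W assms(6,7) by (auto simp: purely_periodic_def)
  next
    case ca
    have P: "P = c + a"
      unfolding assms(10)
      by (rule Least_equality) (use ca assms(2,3) in \<open>auto simp: admissible_period_def\<close>)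
    have shift: "G\<^sub>S (x + P) = G\<^sub>S x" for x
      using nim_S_periodic_ca ca \<rho> P by simp
    then have period: "is_period G\<^sub>S P"
      using a_pos by (simp add: is_period_def P)
    have W: "W\<^sub>S = T_set a b c P"
      by (rule P_positions_S_eq_T_set [OF shift])
        (use P_positions_S_first_gap P_positions_B_initial in \<open>auto simp: P\<close>)
    have "least_period G\<^sub>S = P"
    proof (rule least_period_S [OF period])
      show "x \<in> W\<^sub>B" if "x < P" "x \<in> W\<^sub>S" for x
        using that unfolding W T_set_def by simp
      show "x \<notin> W\<^sub>S" if "P - a \<le> x" "x < P" for x
        using that P_positions_S_first_gap [of "x - c"] by (simp add: P)
      show "P = a + b \<or> \<not> a + b dvd P"
        using Theta_ab_if_dvd [of a] ca \<rho> P by blast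
    \<comment> \<open>If \<open>a\<close> divides both \<open>c + a\<close> and \<open>b\<close>, it
      divides \<open>c\<close>, against \<open>gcd\<close>.\<close>
    qed (use gcd b_less_c P in auto)
    then show ?thesis
      using period ca W assms(6,7) by (auto simp: purely_periodic_def)
  next
    case cb
    have P: "P = c + b"
      unfolding assms(10)
      by (rule Least_equality) (use cb assms(2,3) in \<open>auto simp: admissible_period_def\<close>)
    have shift: "G\<^sub>S (x + P) = G\<^sub>S x" for x
      using nim_S_periodic_cb cb \<rho> P by simp
    then have period: "is_period G\<^sub>S P"
      using a_pos a_less_b by (simp add: is_period_def P)
    have W: "W\<^sub>S = T_set a b c P"
      by (rule P_positions_S_eq_T_set [OF shift])
        (use P_positions_S_add_c_iff cb \<rho> in \<open>auto simp: P\<close>)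
    have "least_period G\<^sub>S = P"
    proof (rule least_period_S [OF period])
      show "x \<in> W\<^sub>B" if "x < P" "x \<in> W\<^sub>S" for x
        using that unfolding W T_set_def by simp
      show "x \<notin> W\<^sub>S" if "P - a \<le> x" "x < P" for x
        using that P_positions_S_last_gap [of "x - c"] cb \<rho> a_less_b by (simp add: P)
      show "P = a + b \<or> \<not> a + b dvd P"
        using Theta_ab_if_dvd [of b] cb \<rho> P by blast
      show "\<not> (a dvd P \<and> a dvd b \<and> odd (b div a))"
        using gcd P by (auto simp: dvd_add_left_iff)
    qed (use a_less_b b_less_c P in auto)
    then show ?thesis
      using period cb W assms(6,7) by (auto simp: purely_periodic_def)
  qed
qed

end
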